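(* Let $n\ge2$ and let $X_1,\dots,X_n$ be independent real random variables, where $X_i$ has the law $P_{\theta_i^\star}$ of a regular one-parameter exponential family $\{P_\theta\}_{\theta\in\Theta}$ with parameter $\theta_i^\star\in\Theta$; let $\boldsymbol\mu^\star=(\mu_1^\star,\dots,\mu_n^\star)$ with $\mu_i^\star=\mathbb{E}[X_i]=b'(\theta_i^\star)$. Let $\pi^\star$ be a permutation of $\{1,\dots,n\}$ with $\mu^\star_{\pi^\star(1)}\ge\cdots\ge\mu^\star_{\pi^\star(n)}$, and let $\widehat{\boldsymbol\mu}$ be the minimizer of $\sum_{i=1}^n(X_i-\mu_i)^2$ subject to $\mu_{\pi^\star(1)}\ge\mu_{\pi^\star(2)}\ge\cdots\ge\mu_{\pi^\star(n)}$. Then $$\mathbb{E}\|\widehat{\boldsymbol\mu}-\boldsymbol\mu^\star\|^2\le\mathbb{E}\|\boldsymbol X-\boldsymbol\mu^\star\|^2,$$ where $\boldsymbol X=(X_1,\dots,X_n)$ and $\|\cdot\|$ is the Euclidean norm.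
   Context: Regular one-parameter exponential family: there are a base measure $\rho$ on $\mathbb{R}$, a carrier function $c\ge 0$, an open interval $\Theta\subseteq\mathbb{R}$, and a log-partition function $b:\Theta\to\mathbb{R}$ such that for each $\theta\in\Theta$, $P_\theta$ has density $p_\theta(x)=e^{\theta x-b(\theta)}c(x)$ with respect to $\rho$; $b$ is twice differentiable with $b''(\theta)>0$ on $\Theta$. One has $\mathbb{E}_\theta[X]=b'(\theta)$ and $\mathrm{Var}_\theta(X)=b''(\theta)\in(0,\infty)$. *)

theory Defs
  imports "HOL-Probability.Probability"
begin

definition exp_family_law ::
  "real measure \<Rightarrow> (real \<Rightarrow> real) \<Rightarrow> (real \<Rightarrow> real) \<Rightarrow> real \<Rightarrow> real measure" where
  "exp_family_law \<rho> c b \<theta> = density \<rho> (\<lambda>x. ennreal (exp (\<theta> * x - b \<theta>) * c x))"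

(* Only the values of b on the open set \<Theta> matter, so b is a total function.
   The mean and variance identities are consequences and are not assumed. *)
locale regular_exp_family =
  fixes \<rho> :: "real measure" and c b :: "real \<Rightarrow> real" and \<Theta> :: "real set"
  assumes sets_base: "sets \<rho> = sets borel"
    and carrier_measurable: "c \<in> borel_measurable borel"
    and carrier_nonneg: "\<And>x. 0 \<le> c x"
    and open_param: "open \<Theta>"
    and interval_param: "is_interval \<Theta>"
    and prob_space_law: "\<And>\<theta>. \<theta> \<in> \<Theta> \<Longrightarrow> prob_space (exp_family_law \<rho> c b \<theta>)"
    and differentiable_log_partition: "\<And>\<theta>. \<theta> \<in> \<Theta> \<Longrightarrow> b field_differentiable at \<theta>"
    and twice_differentiable_log_partition: "\<And>\<theta>. \<theta> \<in> \<Theta> \<Longrightarrow> deriv b field_differentiable at \<theta>"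
    and deriv2_log_partition_pos: "\<And>\<theta>. \<theta> \<in> \<Theta> \<Longrightarrow> 0 < deriv (deriv b) \<theta>"

(* The linear order on the finite index type identifies it with {1..n}. *)
definition isotonic_lse ::
  "('n :: {finite, linorder} \<Rightarrow> 'n) \<Rightarrow> (real, 'n) vec \<Rightarrow> (real, 'n) vec" where
  "isotonic_lse \<pi> x =
     arg_min (\<lambda>m. \<Sum>i\<in>UNIV. (x $ i - m $ i)\<^sup>2) (\<lambda>m. antimono (\<lambda>i. m $ \<pi> i))"

lemma ex1_isotonic_minimizer:
  fixes \<pi> :: "'n :: {finite, linorder} \<Rightarrow> 'n" and x :: "(real, 'n) vec"
  shows "\<exists>!m. is_arg_min (\<lambda>m. \<Sum>i\<in>UNIV. (x $ i - m $ i)\<^sup>2)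
                          (\<lambda>m. antimono (\<lambda>i. m $ \<pi> i)) m"
proof -
  define S where "S = {m :: (real, 'n) vec. antimono (\<lambda>i. m $ \<pi> i)}"
  have S_eq: "S = (\<Inter>i. \<Inter>j\<in>{i..}. {m. m $ \<pi> j \<le> m $ \<pi> i})"
    by (auto simp: S_def monotone_def)
  have "closed S"
    unfolding S_eq by (intro closed_INT ballI closed_Collect_le continuous_intros)
  have "convex S"
    by (rule convexI) (simp add: S_def monotone_def add_mono mult_left_mono)
  have "0 \<in> S"
    by (simp add: S_def monotone_def)
  have sq: "(\<Sum>i\<in>UNIV. (x $ i - m $ i)\<^sup>2) = (dist x m)\<^sup>2" for m
    by (simp add: dist_norm norm_vec_def L2_set_def sum_nonneg)
  have iff: "is_arg_min (\<lambda>m. \<Sum>i\<in>UNIV. (x $ i - m $ i)\<^sup>2)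
                        (\<lambda>m. antimono (\<lambda>i. m $ \<pi> i)) m
        \<longleftrightarrow> m \<in> S \<and> (\<forall>z\<in>S. dist x m \<le> dist x z)" for m
    by (simp add: is_arg_min_linorder sq S_def Ball_def)
  obtain m where "m \<in> S" "\<forall>z\<in>S. dist x m \<le> dist x z"
    using distance_attains_inf[OF \<open>closed S\<close>, of x] \<open>0 \<in> S\<close> by (metis empty_iff)
  then show ?thesis
    unfolding iff
    using closest_point_unique[OF \<open>convex S\<close> \<open>closed S\<close>] by blast
qed

end

theory Submission
  imports Defs
begin

text \<open>
  The law at \<open>\<theta>\<close> has moment generating function \<open>exp (b (\<theta> + t) - b \<theta>)\<close> for small \<open>t\<close>, so it has
  a second moment, and its mean is the derivative \<open>b' \<theta>\<close> of that function at \<open>0\<close>. The estimator is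
  the metric projection onto a closed convex cone that contains \<open>\<mu>\<close>; such a projection is
  1-Lipschitz and fixes \<open>\<mu>\<close>, so the inequality already holds pointwise.
\<close>

text \<open>Taylor's bound at \<open>\<bar>y\<bar>\<close> gives \<open>y\<^sup>2 / 2 \<le> exp
  \<bar>y\<bar> \<le> exp y + exp (- y)\<close>. Taking \<open>y = s * X \<omega>\<close> yields the
  dominating function and its factor \<open>2 / s\<^sup>2\<close>. Both signs of the exponent are
  used because each controls only one tail.\<close>

lemma (in prob_space) square_integrable_if_exp_moments:
  fixes X :: "'a \<Rightarrow> real"
  assumes [measurable]: "X \<in> borel_measurable M"
    and "s > 0" and "integrable M (\<lambda>\<omega>. exp (s * X \<omega>))" and "integrable M (\<lambda>\<omega>. exp (- s * X \<omega>))"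
  shows "integrable M (\<lambda>\<omega>. (X \<omega>)\<^sup>2)"
proof (rule Bochner_Integration.integrable_bound)
  show "integrable M (\<lambda>\<omega>. 2 / s\<^sup>2 * (exp (s * X \<omega>) + exp (- s * X \<omega>)))"
    using assms by simp
  have quad: "y\<^sup>2 / 2 \<le> exp y + exp (- y)" for y :: real
  proof -
    have "y\<^sup>2 / 2 \<le> exp \<bar>y\<bar>"
      using exp_lower_Taylor_quadratic[of "\<bar>y\<bar>"] by simp
    also have "\<dots> \<le> exp y + exp (- y)"
      by (cases "y \<ge> 0") auto
    finally show ?thesis .
  qed
  have "(X \<omega>)\<^sup>2 \<le> 2 / s\<^sup>2 * (exp (s * X \<omega>) + exp (- s * X \<omega>))" for \<omega>
    using quad[of "s * X \<omega>"] \<open>s > 0\<close> by (simp add: field_simps)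
  then show "AE \<omega> in M. norm ((X \<omega>)\<^sup>2) \<le> norm (2 / s\<^sup>2 * (exp (s * X \<omega>) + exp (- s * X \<omega>)))"
    by (intro AE_I2) (simp add: order_trans[OF _ abs_ge_self])
qed measurable

text \<open>Since \<open>exp (t * x) \<ge> 1 + t * x\<close>, the function \<open>t \<mapsto> E[exp (t * X)] - 1 - t * E[X]\<close> has a local
  minimum at \<open>0\<close>, which avoids differentiating under the integral sign.\<close>

lemma (in prob_space) expectation_eq_deriv_mgf:
  fixes X :: "'a \<Rightarrow> real"
  assumes "integrable M X"
    and "\<delta> > 0" and exp_int: "\<And>t. \<bar>t\<bar> < \<delta> \<Longrightarrow> integrable M (\<lambda>\<omega>. exp (t * X \<omega>))"
    and "((\<lambda>t. expectation (\<lambda>\<omega>. exp (t * X \<omega>))) has_real_derivative D) (at 0)"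
  shows "expectation X = D"
proof -
  define g where "g t = expectation (\<lambda>\<omega>. exp (t * X \<omega>)) - t * expectation X" for t
  have "(g has_real_derivative D - expectation X) (at 0)"
    unfolding g_def using assms(4) by (auto intro!: derivative_eq_intros)
  moreover have "g 0 \<le> g t" if "\<bar>0 - t\<bar> < \<delta>" for t
  proof -
    have "expectation (\<lambda>\<omega>. 1 + t * X \<omega>) \<le> expectation (\<lambda>\<omega>. exp (t * X \<omega>))"
      using that assms(1) by (intro integral_mono exp_int exp_ge_add_one_self) auto
    then show ?thesis
      using assms(1) by (simp add: g_def prob_space)
  qed
  ultimately have "D - expectation X = 0"
    using \<open>\<delta> > 0\<close> by (intro DERIV_local_min[where d = \<delta>]) auto
  then show ?thesis
    by simp
qed

context regular_exp_family
begin

text \<open>Exponential tilting stays inside the family: multiplying the density at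
  \<open>\<theta>\<close> by \<open>exp (t * x)\<close> gives the density at
  \<open>\<theta> + t\<close> times a constant, and that density has total mass 1. Computing with
  the nonnegative integral delivers integrability and the value together.\<close>

lemma has_bochner_integral_exp_law:
  assumes "\<theta> \<in> \<Theta>" and "\<theta> + t \<in> \<Theta>"
  shows "has_bochner_integral (exp_family_law \<rho> c b \<theta>) (\<lambda>x. exp (t * x)) (exp (b (\<theta> + t) - b \<theta>))"
proof -
  note [measurable_cong] = sets_base
  note [measurable] = carrier_measurable
  interpret P: prob_space "exp_family_law \<rho> c b (\<theta> + t)"
    using assms(2) by (rule prob_space_law)
  have "(\<integral>\<^sup>+x. ennreal (exp (t * x)) \<partial>exp_family_law \<rho> c b \<theta>)
      = (\<integral>\<^sup>+x. ennreal (exp (\<theta> * x - b \<theta>) * c x) * ennreal (exp (t * x)) \<partial>\<rho>)"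
    unfolding exp_family_law_def by (subst nn_integral_density) auto
  also have "\<dots> = (\<integral>\<^sup>+x. ennreal (exp (b (\<theta> + t) - b \<theta>))
                      * ennreal (exp ((\<theta> + t) * x - b (\<theta> + t)) * c x) \<partial>\<rho>)"
  proof (intro nn_integral_cong)
    fix x
    have "exp (\<theta> * x - b \<theta>) * exp (t * x)
        = exp (b (\<theta> + t) - b \<theta>) * exp ((\<theta> + t) * x - b (\<theta> + t))"
      by (simp add: exp_add[symmetric] algebra_simps)
    then show "ennreal (exp (\<theta> * x - b \<theta>) * c x) * ennreal (exp (t * x))
        = ennreal (exp (b (\<theta> + t) - b \<theta>)) * ennreal (exp ((\<theta> + t) * x - b (\<theta> + t)) * c x)"
      using carrier_nonneg[of x] by (simp add: ennreal_mult[symmetric] mult_ac)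
  qed
  also have "\<dots> = ennreal (exp (b (\<theta> + t) - b \<theta>))
                  * (\<integral>\<^sup>+x. ennreal (exp ((\<theta> + t) * x - b (\<theta> + t)) * c x) \<partial>\<rho>)"
    by (rule nn_integral_cmult) measurable
  also have "(\<integral>\<^sup>+x. ennreal (exp ((\<theta> + t) * x - b (\<theta> + t)) * c x) \<partial>\<rho>)
      = (\<integral>\<^sup>+x. 1 \<partial>exp_family_law \<rho> c b (\<theta> + t))"
    unfolding exp_family_law_def by (subst nn_integral_density) auto
  also have "\<dots> = 1"
    using P.emeasure_space_1 by simp
  finally show ?thesis
    by (intro has_bochner_integral_nn_integral) (auto simp: exp_family_law_def)
qed

lemma moments_law:
  assumes "\<theta> \<in> \<Theta>"
  shows integrable_square_law: "integrable (exp_family_law \<rho> c b \<theta>) (\<lambda>x. x\<^sup>2)"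
    and integrable_law: "integrable (exp_family_law \<rho> c b \<theta>) (\<lambda>x. x)"
    and mean_law: "integral\<^sup>L (exp_family_law \<rho> c b \<theta>) (\<lambda>x. x) = deriv b \<theta>"
proof -
  interpret P: prob_space "exp_family_law \<rho> c b \<theta>"
    using assms by (rule prob_space_law)
  have [measurable]: "(\<lambda>x. x) \<in> borel_measurable (exp_family_law \<rho> c b \<theta>)"
    by (simp add: exp_family_law_def measurable_ident_sets sets_base)
  \<comment> \<open>Openness of \<open>\<Theta>\<close> leaves room on both sides of
    \<open>\<theta>\<close>, so the moment generating function is finite for small \<open>t\<close>
    of either sign.\<close>
  obtain \<delta> where "\<delta> > 0" and ball: "\<And>t. \<bar>t\<bar> < \<delta> \<Longrightarrow> \<theta> + t \<in> \<Theta>"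
    using open_param assms by (force simp: open_dist dist_real_def)
  note mgf = has_bochner_integral_exp_law[OF assms ball]
  have exp_int: "integrable (exp_family_law \<rho> c b \<theta>) (\<lambda>x. exp (t * x))" if "\<bar>t\<bar> < \<delta>" for t
    using mgf[OF that] by (rule integrable.intros)
  \<comment> \<open>The exponents \<open>\<delta> / 2\<close> and \<open>- (\<delta> / 2)\<close>
    both lie strictly inside the range of \<open>exp_int\<close>.\<close>
  show sq: "integrable (exp_family_law \<rho> c b \<theta>) (\<lambda>x. x\<^sup>2)"
    using \<open>\<delta> > 0\<close> exp_int[of "\<delta> / 2"] exp_int[of "- (\<delta> / 2)"]
    by (intro P.square_integrable_if_exp_moments[of _ "\<delta> / 2"]) auto
  show int: "integrable (exp_family_law \<rho> c b \<theta>) (\<lambda>x. x)"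
    using _ sq by (rule P.square_integrable_imp_integrable) measurable
  \<comment> \<open>The point is written \<open>\<theta> + 0\<close> to match the chain rule for
    \<open>t \<mapsto> b (\<theta> + t)\<close> at \<open>t = 0\<close>; there the outer exponential
    contributes the factor \<open>exp 0 = 1\<close>.\<close>
  have "(b has_real_derivative deriv b \<theta>) (at (\<theta> + 0))"
    using differentiable_log_partition[OF assms] by (simp add: DERIV_deriv_iff_field_differentiable)
  then have "((\<lambda>t. exp (b (\<theta> + t) - b \<theta>)) has_real_derivative deriv b \<theta>) (at 0)"
    by (auto intro!: derivative_eq_intros DERIV_chain2[where f = b])
  \<comment> \<open>The closed form of the moment generating function is known only for
    \<open>\<bar>t\<bar> < \<delta>\<close>. Agreement on a neighbourhood of 0 suffices to transfer
    the derivative.\<close>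
  moreover have "eventually (\<lambda>t. \<bar>t\<bar> < \<delta>) (nhds (0::real))"
    using eventually_nhds_metric[of _ "0::real"] \<open>\<delta> > 0\<close> by (auto simp: dist_real_def)
  then have "eventually (\<lambda>t. exp (b (\<theta> + t) - b \<theta>) = P.expectation (\<lambda>x. exp (t * x))) (nhds 0)"
    by eventually_elim (simp add: has_bochner_integral_integral_eq[OF mgf])
  then have "((\<lambda>t. exp (b (\<theta> + t) - b \<theta>)) has_real_derivative deriv b \<theta>) (at 0)
     \<longleftrightarrow> ((\<lambda>t. P.expectation (\<lambda>x. exp (t * x))) has_real_derivative deriv b \<theta>) (at 0)"
    by (intro DERIV_cong_ev refl)
  ultimately have
    "((\<lambda>t. P.expectation (\<lambda>x. exp (t * x))) has_real_derivative deriv b \<theta>) (at 0)"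
    by blast
  then show "P.expectation (\<lambda>x. x) = deriv b \<theta>"
    using int \<open>\<delta> > 0\<close> exp_int by (intro P.expectation_eq_deriv_mgf)
qed

end

abbreviation isotonic_cone :: "('n :: {finite, linorder} \<Rightarrow> 'n) \<Rightarrow> (real, 'n) vec set" where
  "isotonic_cone \<pi> \<equiv> {m. antimono (\<lambda>i. m $ \<pi> i)}"

lemma closed_isotonic_cone: "closed (isotonic_cone \<pi>)"
proof -
  have "isotonic_cone \<pi> = (\<Inter>i. \<Inter>j\<in>{i..}. {m. m $ \<pi> j \<le> m $ \<pi> i})"
    by (auto simp: monotone_def)
  then show ?thesis
    by (simp only:) (intro closed_INT ballI closed_Collect_le continuous_intros)
qed

lemma convex_isotonic_cone: "convex (isotonic_cone \<pi>)"
  by (rule convexI) (simp add: monotone_def add_mono mult_left_mono)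

lemma isotonic_cone_nonempty: "isotonic_cone \<pi> \<noteq> {}"
proof -
  have "0 \<in> isotonic_cone \<pi>"
    by (simp add: monotone_def)
  then show ?thesis
    by blast
qed

text \<open>Minimizing the squared distance and minimizing the distance select the same points, so
  both sides are Hilbert choices from one and the same predicate. Equality therefore follows without
  appeal to uniqueness.\<close>

lemma isotonic_lse_eq_closest_point: "isotonic_lse \<pi> x = closest_point (isotonic_cone \<pi>) x"
proof -
  have "(\<Sum>i\<in>UNIV. (x $ i - m $ i)\<^sup>2) = (dist x m)\<^sup>2" for m
    by (simp add: dist_norm norm_vec_def L2_set_def sum_nonneg)
  then show ?thesis
    by (simp add: isotonic_lse_def arg_min_def is_arg_min_linorder closest_point_def Ball_def)
qed

lemma norm_isotonic_lse_diff_le: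
  assumes "antimono (\<lambda>i. \<mu> $ \<pi> i)"
  shows "norm (isotonic_lse \<pi> x - \<mu>) \<le> norm (x - \<mu>)"
proof -
  have "closest_point (isotonic_cone \<pi>) \<mu> = \<mu>"
    using assms by (simp add: closest_point_self)
  then show ?thesis
    using closest_point_lipschitz[OF convex_isotonic_cone closed_isotonic_cone
        isotonic_cone_nonempty, of \<pi> x \<mu>]
    by (simp add: isotonic_lse_eq_closest_point dist_norm)
qed

text \<open>Projection onto a nonempty closed convex set is continuous. The measurability is what
  lets the pointwise bound on the error yield its integrability.\<close>

lemma borel_measurable_isotonic_lse: "isotonic_lse \<pi> \<in> borel_measurable borel"
  unfolding isotonic_lse_eq_closest_point[abs_def]
  using convex_isotonic_cone closed_isotonic_cone isotonic_cone_nonempty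
  by (intro borel_measurable_continuous_onI continuous_on_closest_point)

theorem proposition2:
  fixes M :: "'w measure"
    and X :: "'n :: {finite, linorder} \<Rightarrow> 'w \<Rightarrow> real"
    and \<theta> :: "'n \<Rightarrow> real"
    and \<mu> :: "(real, 'n) vec"
    and \<pi> :: "'n \<Rightarrow> 'n"
    and \<rho> :: "real measure" and c b :: "real \<Rightarrow> real" and \<Theta> :: "real set"
  assumes "CARD('n) \<ge> 2"
    and "regular_exp_family \<rho> c b \<Theta>"
    and "prob_space M"
    and "prob_space.indep_vars M (\<lambda>_. borel) X UNIV"
    and "\<And>i. \<theta> i \<in> \<Theta>"
    and "\<And>i. distr M borel (X i) = exp_family_law \<rho> c b (\<theta> i)"
    and "\<And>i. \<mu> $ i = prob_space.expectation M (X i)"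
    and "\<pi> permutes UNIV"
    and "antimono (\<lambda>i. \<mu> $ \<pi> i)"
  shows "(\<forall>i. integrable M (X i) \<and> \<mu> $ i = deriv b (\<theta> i))
    \<and> integrable M (\<lambda>\<omega>. (norm (isotonic_lse \<pi> (\<chi> i. X i \<omega>) - \<mu>))\<^sup>2)
    \<and> integrable M (\<lambda>\<omega>. (norm ((\<chi> i. X i \<omega>) - \<mu>))\<^sup>2)
    \<and> prob_space.expectation M (\<lambda>\<omega>. (norm (isotonic_lse \<pi> (\<chi> i. X i \<omega>) - \<mu>))\<^sup>2)
        \<le> prob_space.expectation M (\<lambda>\<omega>. (norm ((\<chi> i. X i \<omega>) - \<mu>))\<^sup>2)"
proof -
  interpret regular_exp_family \<rho> c b \<Theta>
    by fact
  interpret prob_space M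
    by fact
  have X [measurable]: "X i \<in> borel_measurable M" for i
    using assms(4) by (auto simp: indep_vars_def)
  \<comment> \<open>Moments of \<open>X i\<close> are read off from its law by change of variables
    along \<open>distr\<close>.\<close>
  have int: "integrable M (X i)" for i
    using integrable_law[OF assms(5)[of i]] unfolding assms(6)[symmetric]
    by (subst (asm) integrable_distr_eq) auto
  have "integrable M (\<lambda>\<omega>. (X i \<omega>)\<^sup>2)" for i
    using integrable_square_law[OF assms(5)[of i]] unfolding assms(6)[symmetric]
    by (subst (asm) integrable_distr_eq) auto
  then have int_sq: "integrable M (\<lambda>\<omega>. (X i \<omega> - \<mu> $ i)\<^sup>2)" for i
    using int by (simp add: power2_diff)
  have mean: "\<mu> $ i = deriv b (\<theta> i)" for i
    using mean_law[OF assms(5)[of i]] unfolding assms(6)[symmetric] assms(7)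
    by (subst (asm) integral_distr) auto
  \<comment> \<open>Measurability is checked against the standard basis: the inner product with an
    axis vector picks out one coordinate \<open>X i\<close>.\<close>
  have vec [measurable]: "(\<lambda>\<omega>. \<chi> i. X i \<omega>) \<in> borel_measurable M"
    by (subst borel_measurable_euclidean_space) (auto simp: Basis_vec_def inner_axis)
  note [measurable] = borel_measurable_isotonic_lse
  have "(norm ((\<chi> i. X i \<omega>) - \<mu>))\<^sup>2 = (\<Sum>i\<in>UNIV. (X i \<omega> - \<mu> $ i)\<^sup>2)" for \<omega>
    by (simp add: norm_vec_def L2_set_def sum_nonneg)
  then have int_error: "integrable M (\<lambda>\<omega>. (norm ((\<chi> i. X i \<omega>) - \<mu>))\<^sup>2)"
    using int_sq by simp
  \<comment> \<open>This bound serves twice: as domination, giving integrability of the estimator's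
    squared error, and then under the integral for the final inequality.\<close>
  have le: "(norm (isotonic_lse \<pi> (\<chi> i. X i \<omega>) - \<mu>))\<^sup>2 \<le> (norm ((\<chi> i. X i \<omega>) - \<mu>))\<^sup>2" for \<omega>
    by (intro power_mono norm_isotonic_lse_diff_le assms(9) norm_ge_zero)
  have int_lse: "integrable M (\<lambda>\<omega>. (norm (isotonic_lse \<pi> (\<chi> i. X i \<omega>) - \<mu>))\<^sup>2)"
    using int_error by (rule Bochner_Integration.integrable_bound) (use le in auto)
  show ?thesis
    using int mean int_lse int_error integral_mono[OF int_lse int_error le] by simp
qed

end
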